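(* Let $f$ be an everywhere differentiable mapping from an open subset of $\mathbb{R}^q$ into $\mathbb{R}^q$, and let $A\in\mathbb{R}^{q\times q}$ be a non-singular matrix. Suppose that for some $\theta_0\in\mathbb{R}^q$, $r>0$ (with $B(\theta_0,r)$ contained in the domain of $f$) and $\varepsilon\in[0,1)$, $$\|A^{-1}(A-\nabla f(\theta))\|_{op}\le\varepsilon\quad\text{for all }\theta\in B(\theta_0,r),$$ and $$\|A^{-1}f(\theta_0)\|_2\le r(1-\varepsilon).$$ Then there exists a unique vector $\theta^\star\in B(\theta_0,r)$ satisfying $f(\theta^\star)=0$, and $$\frac{1}{1+\varepsilon}\|A^{-1}f(\theta_0)\|_2\le\|\theta^\star-\theta_0\|_2\le\frac{1}{1-\varepsilon}\|A^{-1}f(\theta_0)\|_2.$$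
   Context: $B(\theta_0,r):=\{\theta\in\mathbb{R}^q:\|\theta-\theta_0\|_2\le r\}$ is the closed Euclidean ball. $\|\cdot\|_{op}$ is the operator norm of a matrix (induced by the Euclidean norm). $\nabla f(\theta)\in\mathbb{R}^{q\times q}$ is the derivative (Jacobian matrix) of $f$ at $\theta$. *)

theory Defs
  imports "HOL-Analysis.Analysis"
begin

end

theory Submission
  imports Defs
begin

text \<open>
  Zeros of f are the fixed points of the simplified Newton map
  g(\<theta>) = \<theta> - A^{-1} f(\<theta>), whose derivative A^{-1} (A - \<nabla>f(\<theta>)) makes it an
  \<epsilon>-contraction on the ball. The Banach fixed point theorem applies, since
  |g(\<theta>) - \<theta>0| \<le> \<epsilon> |\<theta> - \<theta>0| + |A^{-1} f(\<theta>0)| \<le> r on the ball. At a zero \<theta>* the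
  difference of \<theta>* - \<theta>0 and -A^{-1} f(\<theta>0) is g(\<theta>*) - g(\<theta>0), of norm at most
  \<epsilon> |\<theta>* - \<theta>0|, which gives both bounds.
\<close>

text \<open>\<open>matrix_inv\<close> is a choice of a two-sided inverse, so invertibility yields
  both equations at once.\<close>

lemma matrix_inv_left_right:
  fixes A :: "'a::semiring_1^'n^'m"
  assumes "invertible A"
  shows "A ** matrix_inv A = mat 1" "matrix_inv A ** A = mat 1"
  using someI_ex[OF assms[unfolded invertible_def]] by (simp_all add: matrix_inv_def)

text \<open>The image of the ball lies within \<open>c * r\<close> of \<open>g a\<close>, and
  \<open>g a\<close> is displaced from \<open>a\<close> by at most the remaining
  \<open>r * (1 - c)\<close>. So the complete set \<open>cball a r\<close> is mapped into
  itself.\<close>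

lemma contraction_cball_fixpoint:
  fixes g :: "'a::{complete_space,real_normed_vector} \<Rightarrow> 'a"
  assumes "0 \<le> r" "0 \<le> c" "c < 1"
    and lipschitz: "\<And>x y. x \<in> cball a r \<Longrightarrow> y \<in> cball a r \<Longrightarrow> norm (g x - g y) \<le> c * norm (x - y)"
    and centre: "norm (g a - a) \<le> r * (1 - c)"
  shows "\<exists>!x\<in>cball a r. g x = x"
proof (rule Banach_fix)
  show "g ` cball a r \<subseteq> cball a r"
  proof (rule image_subsetI)
    fix x assume x: "x \<in> cball a r"
    have "norm (g x - a) \<le> norm (g x - g a) + norm (g a - a)"
      using norm_triangle_ineq[of "g x - g a" "g a - a"] by simp
    also have "\<dots> \<le> c * norm (x - a) + r * (1 - c)"
      using lipschitz[OF x, of a] centre \<open>0 \<le> r\<close> by simp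
    also have "\<dots> \<le> c * r + r * (1 - c)"
      using x \<open>0 \<le> c\<close> by (simp add: dist_norm norm_minus_commute mult_left_mono)
    finally show "g x \<in> cball a r"
      by (simp add: dist_norm norm_minus_commute algebra_simps)
  qed
qed (use assms in \<open>auto simp: dist_norm complete_eq_closed\<close>)

text \<open>At a fixed point, \<open>x - a\<close> is the sum of \<open>g x - g a\<close> and
  \<open>g a - a\<close>. The first summand has norm at most \<open>c * norm (x - a)\<close>, which
  is absorbed on either side of the triangle inequality.\<close>

lemma contraction_fixpoint_dist:
  fixes g :: "'a::real_normed_vector \<Rightarrow> 'a"
  assumes "0 \<le> c" "c < 1" and "norm (g x - g a) \<le> c * norm (x - a)" and "g x = x"
  shows "1 / (1 + c) * norm (g a - a) \<le> norm (x - a)"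
    and "norm (x - a) \<le> 1 / (1 - c) * norm (g a - a)"
proof -
  have "norm (g a - a) \<le> norm (x - a) + norm (g x - g a)"
    using norm_triangle_ineq4[of "x - a" "g x - g a"] \<open>g x = x\<close> by simp
  then show "1 / (1 + c) * norm (g a - a) \<le> norm (x - a)"
    using assms by (simp add: field_simps)
  have "norm (x - a) \<le> norm (g x - g a) + norm (g a - a)"
    using norm_triangle_ineq[of "g x - g a" "g a - a"] \<open>g x = x\<close> by simp
  then show "norm (x - a) \<le> 1 / (1 - c) * norm (g a - a)"
    using assms by (simp add: field_simps)
qed

theorem theorem2p1:
  fixes f :: "real ^ 'q \<Rightarrow> real ^ 'q"
    and U :: "(real ^ 'q) set"
    and A :: "real ^ 'q ^ 'q"
    and \<theta>\<^sub>0 :: "real ^ 'q"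
    and r \<epsilon> :: real
  assumes "open U"
    and "\<forall>\<theta>\<in>U. f differentiable (at \<theta>)"
    and "invertible A"
    and "r > 0"
    and "cball \<theta>\<^sub>0 r \<subseteq> U"
    and "0 \<le> \<epsilon>" and "\<epsilon> < 1"
    and "\<forall>\<theta>\<in>cball \<theta>\<^sub>0 r. onorm ((*v) (matrix_inv A ** (A - jacobian f (at \<theta>)))) \<le> \<epsilon>"
    and "norm (matrix_inv A *v f \<theta>\<^sub>0) \<le> r * (1 - \<epsilon>)"
  shows "(\<exists>!\<theta>. \<theta> \<in> cball \<theta>\<^sub>0 r \<and> f \<theta> = 0) \<and>
    (\<forall>\<theta>\<in>cball \<theta>\<^sub>0 r. f \<theta> = 0 \<longrightarrow>
      1 / (1 + \<epsilon>) * norm (matrix_inv A *v f \<theta>\<^sub>0) \<le> norm (\<theta> - \<theta>\<^sub>0) \<and>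
      norm (\<theta> - \<theta>\<^sub>0) \<le> 1 / (1 - \<epsilon>) * norm (matrix_inv A *v f \<theta>\<^sub>0))"
proof -
  define g where "g \<theta> = \<theta> - matrix_inv A *v f \<theta>" for \<theta>
  have zero_iff: "g \<theta> = \<theta> \<longleftrightarrow> f \<theta> = 0" for \<theta>
  proof
    assume "g \<theta> = \<theta>"
    then have "A *v (matrix_inv A *v f \<theta>) = 0"
      by (simp add: g_def)
    then show "f \<theta> = 0"
      using \<open>invertible A\<close> by (simp add: matrix_vector_mul_assoc matrix_inv_left_right)
  qed (simp add: g_def)
  have deriv: "(g has_derivative (*v) (matrix_inv A ** (A - jacobian f (at \<theta>))))
      (at \<theta> within cball \<theta>\<^sub>0 r)" if "\<theta> \<in> cball \<theta>\<^sub>0 r" for \<theta>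
  proof -
    have "(f has_derivative (*v) (jacobian f (at \<theta>))) (at \<theta>)"
      using assms that by (auto simp flip: jacobian_works)
    then have "(g has_derivative (\<lambda>h. h - matrix_inv A *v (jacobian f (at \<theta>) *v h))) (at \<theta>)"
      unfolding g_def
      by (intro has_derivative_diff has_derivative_ident
          bounded_linear.has_derivative[OF matrix_vector_mul_bounded_linear])
    \<comment> \<open>Writing \<open>h\<close> as \<open>matrix_inv A *v (A *v h)\<close> gives the
      derivative the form bounded in the hypothesis.\<close>
    moreover have "h - matrix_inv A *v (jacobian f (at \<theta>) *v h)
        = (matrix_inv A ** (A - jacobian f (at \<theta>))) *v h" for h
      using \<open>invertible A\<close>
      by (simp add: matrix_vector_mult_diff_rdistrib matrix_vector_mult_diff_distrib
          flip: matrix_vector_mul_assoc)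
        (simp add: matrix_vector_mul_assoc matrix_inv_left_right)
    ultimately show ?thesis
      by (simp add: has_derivative_at_withinI)
  qed
  have lipschitz: "norm (g x - g y) \<le> \<epsilon> * norm (x - y)"
    if "x \<in> cball \<theta>\<^sub>0 r" "y \<in> cball \<theta>\<^sub>0 r" for x y
    using differentiable_bound[OF convex_cball deriv _ that] assms by blast
  \<comment> \<open>The displacement of the centre is the first Newton step, up to sign the vector
    in the hypothesis and in both bounds.\<close>
  have centre: "norm (g \<theta>\<^sub>0 - \<theta>\<^sub>0) = norm (matrix_inv A *v f \<theta>\<^sub>0)"
    by (simp add: g_def)
  have "\<exists>!\<theta>\<in>cball \<theta>\<^sub>0 r. g \<theta> = \<theta>"
    using assms centre by (intro contraction_cball_fixpoint[OF _ _ _ lipschitz]) auto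
  moreover have "1 / (1 + \<epsilon>) * norm (g \<theta>\<^sub>0 - \<theta>\<^sub>0) \<le> norm (\<theta> - \<theta>\<^sub>0) \<and>
      norm (\<theta> - \<theta>\<^sub>0) \<le> 1 / (1 - \<epsilon>) * norm (g \<theta>\<^sub>0 - \<theta>\<^sub>0)"
    if "\<theta> \<in> cball \<theta>\<^sub>0 r" "g \<theta> = \<theta>" for \<theta>
    using contraction_fixpoint_dist[of \<epsilon> g \<theta> \<theta>\<^sub>0] lipschitz[of \<theta> \<theta>\<^sub>0] that assms by auto
  ultimately show ?thesis
    unfolding zero_iff centre by blast
qed

end
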